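(* For every positive integer $k$ there exist a constant $c(k)>0$ (depending only on $k$) and an integer $N_0(k)$ such that for every integer $N \geq N_0(k)$ there exists a degree two polynomial morphism $\phi:\mathbb{P}^N \to \mathbb{P}^N$ defined over $\mathbb{Q}$ which has a $\mathbb{Q}$-rational periodic point with primitive period larger than $c(k)N^k$.
   Context: A degree two polynomial map $\phi:\mathbb{P}^N \to \mathbb{P}^N$ over $\mathbb{Q}$, in coordinates $[x_0,\ldots,x_N]$, is a map of the form $\phi = [\phi_0,\ldots,\phi_{N-1},x_N^2]$, where each $\phi_i$ is a homogeneous form of degree $2$ in $x_0,\ldots,x_N$ with rational coefficients. It is a morphism if $\phi_0,\ldots,\phi_{N-1}$ have no nontrivial common zero (over $\overline{\mathbb{Q}}$) when $x_N=0$. A point $P$ is periodic of period $n\ge 1$ for $\phi$ if $\phi^n(P)=P$, where $\phi^n$ is the $n$-th iterate; the smallest such $n$ is its primitive period. *)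

theory Defs
  imports Complex_Main "HOL-Computational_Algebra.Polynomial"
begin

text \<open>Homogeneous coordinates \<open>x\<^sub>0, \<dots>, x\<^sub>N\<close> are functions on \<open>nat\<close> that vanish beyond the index \<open>N\<close>,
  so that equality of coordinate vectors is equality of functions.\<close>

definition hcoords :: "nat \<Rightarrow> (nat \<Rightarrow> 'a::field) set" where
  "hcoords N = {x. (\<forall>i>N. x i = 0) \<and> (\<exists>i\<le>N. x i \<noteq> 0)}"

definition proj_rel :: "nat \<Rightarrow> ((nat \<Rightarrow> 'a::field) \<times> (nat \<Rightarrow> 'a)) set" where
  "proj_rel N = {(x, y). x \<in> hcoords N \<and> y \<in> hcoords N \<and> (\<exists>c. c \<noteq> 0 \<and> y = (\<lambda>i. c * x i))}"

definition proj_space :: "nat \<Rightarrow> (nat \<Rightarrow> 'a::field) set set" where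
  "proj_space N = hcoords N // proj_rel N"

text \<open>The quadratic form over \<open>\<rat>\<close> whose coefficient at the monomial \<open>x\<^sub>i x\<^sub>j\<close> (for \<open>i \<le> j \<le> N\<close>) is
  \<open>a i j\<close>, evaluated over an arbitrary extension field of \<open>\<rat>\<close>.\<close>

definition quad_form :: "nat \<Rightarrow> (nat \<Rightarrow> nat \<Rightarrow> rat) \<Rightarrow> (nat \<Rightarrow> 'a::field_char_0) \<Rightarrow> 'a" where
  "quad_form N a x = (\<Sum>j\<le>N. \<Sum>i\<le>j. of_rat (a i j) * x i * x j)"

text \<open>A family \<open>\<phi>\<close> of coefficient tables stands for \<open>[\<phi>\<^sub>0, \<dots>, \<phi>\<^bsub>N-1\<^esub>, x\<^sub>N\<^sup>2]\<close>; only the tables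
  \<open>\<phi> m\<close> with \<open>m < N\<close> are used.\<close>

definition poly_lift ::
  "nat \<Rightarrow> (nat \<Rightarrow> nat \<Rightarrow> nat \<Rightarrow> rat) \<Rightarrow> (nat \<Rightarrow> 'a::field_char_0) \<Rightarrow> nat \<Rightarrow> 'a" where
  "poly_lift N \<phi> x =
     (\<lambda>m. if m < N then quad_form N (\<phi> m) x else if m = N then (x N)\<^sup>2 else 0)"

text \<open>\<open>\<rat>\<close>'s algebraic closure is taken to be the field of algebraic complex numbers.\<close>

definition poly_morphism :: "nat \<Rightarrow> (nat \<Rightarrow> nat \<Rightarrow> nat \<Rightarrow> rat) \<Rightarrow> bool" where
  "poly_morphism N \<phi> \<longleftrightarrow>
     (\<forall>z :: nat \<Rightarrow> complex.
        (\<forall>i\<le>N. algebraic (z i)) \<and> z N = 0 \<and> (\<forall>m<N. quad_form N (\<phi> m) z = 0)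
        \<longrightarrow> (\<forall>i\<le>N. z i = 0))"

text \<open>The map induced on classes. It is well defined on rational points when \<open>\<phi>\<close> is a morphism; see
  \<open>proj_map_class\<close> and \<open>proj_map_closed\<close> below.\<close>

definition proj_map ::
  "nat \<Rightarrow> (nat \<Rightarrow> nat \<Rightarrow> nat \<Rightarrow> rat) \<Rightarrow> (nat \<Rightarrow> 'a::field_char_0) set \<Rightarrow> (nat \<Rightarrow> 'a) set" where
  "proj_map N \<phi> P = (\<Union>x\<in>P. proj_rel N `` {poly_lift N \<phi> x})"

definition has_period :: "('b \<Rightarrow> 'b) \<Rightarrow> 'b \<Rightarrow> nat \<Rightarrow> bool" where
  "has_period f P n \<longleftrightarrow> n \<ge> 1 \<and> (f ^^ n) P = P"

definition is_periodic :: "('b \<Rightarrow> 'b) \<Rightarrow> 'b \<Rightarrow> bool" where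
  "is_periodic f P \<longleftrightarrow> (\<exists>n. has_period f P n)"

definition primitive_period :: "('b \<Rightarrow> 'b) \<Rightarrow> 'b \<Rightarrow> nat" where
  "primitive_period f P = (LEAST n. has_period f P n)"

lemma equiv_proj_rel:
  "equiv (hcoords N) (proj_rel N :: ((nat \<Rightarrow> 'a::field) \<times> (nat \<Rightarrow> 'a)) set)"
proof (rule equivI)
  show "(proj_rel N :: ((nat \<Rightarrow> 'a) \<times> (nat \<Rightarrow> 'a)) set) \<subseteq> hcoords N \<times> hcoords N"
    by (auto simp: proj_rel_def)
  show "refl_on (hcoords N) (proj_rel N :: ((nat \<Rightarrow> 'a) \<times> (nat \<Rightarrow> 'a)) set)"
    by (auto simp: refl_on_def proj_rel_def intro!: exI[of _ 1])
  show "sym (proj_rel N :: ((nat \<Rightarrow> 'a) \<times> (nat \<Rightarrow> 'a)) set)"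
  proof (rule symI)
    fix x y :: "nat \<Rightarrow> 'a"
    assume "(x, y) \<in> proj_rel N"
    then obtain c where c: "x \<in> hcoords N" "y \<in> hcoords N" "c \<noteq> 0" "y = (\<lambda>i. c * x i)"
      by (auto simp: proj_rel_def)
    then have "x = (\<lambda>i. inverse c * y i)" "inverse c \<noteq> 0"
      by (auto simp: field_simps)
    with c(1,2) show "(y, x) \<in> proj_rel N"
      unfolding proj_rel_def by blast
  qed
  show "trans (proj_rel N :: ((nat \<Rightarrow> 'a) \<times> (nat \<Rightarrow> 'a)) set)"
  proof (rule transI)
    fix x y z :: "nat \<Rightarrow> 'a"
    assume "(x, y) \<in> proj_rel N" "(y, z) \<in> proj_rel N"
    then obtain c d where cd: "x \<in> hcoords N" "z \<in> hcoords N" "c \<noteq> 0" "d \<noteq> 0"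
        "y = (\<lambda>i. c * x i)" "z = (\<lambda>i. d * y i)"
      by (auto simp: proj_rel_def)
    then have "z = (\<lambda>i. (d * c) * x i)" "d * c \<noteq> 0"
      by (auto simp: mult.assoc)
    with cd(1,2) show "(x, z) \<in> proj_rel N"
      unfolding proj_rel_def by blast
  qed
qed

lemma quad_form_scale: "quad_form N a (\<lambda>i. c * x i) = c\<^sup>2 * quad_form N a x"
  by (simp add: quad_form_def sum_distrib_left power2_eq_square algebra_simps)

lemma poly_lift_scale: "poly_lift N \<phi> (\<lambda>i. c * x i) = (\<lambda>m. c\<^sup>2 * poly_lift N \<phi> x m)"
  by (auto simp: poly_lift_def quad_form_scale power_mult_distrib fun_eq_iff)

lemma quad_form_of_rat:
  "quad_form N a (\<lambda>i. of_rat (x i) :: complex) = of_rat (quad_form N a x)"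
  by (simp add: quad_form_def of_rat_sum of_rat_mult)

lemma poly_lift_hcoords:
  fixes x :: "nat \<Rightarrow> rat"
  assumes "poly_morphism N \<phi>" "x \<in> hcoords N"
  shows "poly_lift N \<phi> x \<in> hcoords N"
proof (rule ccontr)
  assume "poly_lift N \<phi> x \<notin> hcoords N"
  moreover have "\<forall>i>N. poly_lift N \<phi> x i = 0"
    by (simp add: poly_lift_def)
  ultimately have zero: "poly_lift N \<phi> x i = 0" if "i \<le> N" for i
    using that by (auto simp: hcoords_def)
  have "x N = 0"
    using zero[of N] by (simp add: poly_lift_def)
  moreover have "quad_form N (\<phi> m) x = 0" if "m < N" for m
    using zero[of m] that by (simp add: poly_lift_def)
  moreover have "algebraic (of_rat q :: complex)" for q
    by (rule rat_imp_algebraic) simp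
  ultimately have "\<forall>i\<le>N. (of_rat (x i) :: complex) = 0"
    using assms(1)[unfolded poly_morphism_def, rule_format, of "\<lambda>i. of_rat (x i)"]
    by (simp add: quad_form_of_rat)
  with assms(2) show False
    by (auto simp: hcoords_def)
qed

lemma proj_map_class:
  fixes x :: "nat \<Rightarrow> rat"
  assumes "poly_morphism N \<phi>" "x \<in> hcoords N"
  shows "proj_map N \<phi> (proj_rel N `` {x}) = proj_rel N `` {poly_lift N \<phi> x}"
proof -
  have "(\<lambda>y. proj_rel N `` {poly_lift N \<phi> y}) respects (proj_rel N :: ((nat \<Rightarrow> rat) \<times> _) set)"
  proof (rule congruentI)
    fix y z :: "nat \<Rightarrow> rat"
    assume "(y, z) \<in> proj_rel N"
    then obtain c where c: "y \<in> hcoords N" "z \<in> hcoords N" "c \<noteq> 0" "z = (\<lambda>i. c * y i)"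
      by (auto simp: proj_rel_def)
    then have "poly_lift N \<phi> z = (\<lambda>m. c\<^sup>2 * poly_lift N \<phi> y m)" "c\<^sup>2 \<noteq> 0"
      by (simp_all add: poly_lift_scale)
    moreover have "poly_lift N \<phi> y \<in> hcoords N" "poly_lift N \<phi> z \<in> hcoords N"
      using assms(1) c(1,2) by (auto intro: poly_lift_hcoords)
    ultimately have "(poly_lift N \<phi> y, poly_lift N \<phi> z) \<in> proj_rel N"
      unfolding proj_rel_def by blast
    then show "proj_rel N `` {poly_lift N \<phi> y} = proj_rel N `` {poly_lift N \<phi> z}"
      by (rule equiv_class_eq[OF equiv_proj_rel])
  qed
  then show ?thesis
    unfolding proj_map_def using UN_equiv_class[OF equiv_proj_rel _ assms(2)] by blast
qed

lemma proj_map_closed: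
  fixes P :: "(nat \<Rightarrow> rat) set"
  assumes "poly_morphism N \<phi>" "P \<in> proj_space N"
  shows "proj_map N \<phi> P \<in> proj_space N"
  using assms by (auto simp: proj_space_def proj_map_class poly_lift_hcoords elim!: quotientE intro!: quotientI)

end

theory Submission
  imports Defs "HOL-Number_Theory.Cong"
begin

text \<open>In the affine chart \<open>x\<^sub>N = 1\<close> consider \<open>x\<^sub>m \<mapsto> x\<^sub>m\<^sup>2 - x\<^sub>m + x\<^bsub>\<sigma> m\<^esub>\<close> for a self-map \<open>\<sigma>\<close> of the indices.
  The leading forms \<open>x\<^sub>m\<^sup>2\<close> make it a morphism, and on points with all coordinates in \<open>{0, 1}\<close> it is
  just \<open>x \<mapsto> x \<circ> \<sigma>\<close>. If \<open>\<sigma>\<close> has \<open>k\<close> cycles of pairwise coprime lengths, then the indicator of a set with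
  exactly one index on each of these cycles has the product of the lengths as its primitive period. The
  lengths \<open>1 + (i + 1) M\<close> for \<open>i < k\<close>, where \<open>M\<close> is a multiple of \<open>k!\<close> proportional to \<open>N\<close>, are pairwise
  coprime, have sum at most \<open>N\<close>, and have product of order \<open>N\<^sup>k\<close>.\<close>

lemma quad_form_add:
  "quad_form N (\<lambda>i j. a i j + b i j) x = quad_form N a x + quad_form N b x"
  by (simp add: quad_form_def of_rat_add algebra_simps sum.distrib)

lemma quad_form_diff:
  "quad_form N (\<lambda>i j. a i j - b i j) x = quad_form N a x - quad_form N b x"
  by (simp add: quad_form_def of_rat_diff algebra_simps sum_subtractf)

lemma quad_form_monomial:
  assumes "p \<le> q" "q \<le> N"
  shows "quad_form N (\<lambda>i j. if j = q then if i = p then 1 else 0 else 0) x = x p * x q"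
proof -
  have "quad_form N (\<lambda>i j. if j = q then if i = p then 1 else 0 else 0) x
      = (\<Sum>j\<le>N. if j = q then \<Sum>i\<le>j. if i = p then x i * x j else 0 else 0)"
    unfolding quad_form_def
  proof (intro sum.cong refl)
    fix j
    have "of_rat (if j = q then if i = p then 1 else 0 else 0) * x i * x j
        = (if j = q then if i = p then x i * x j else 0 else 0)" for i
      by simp
    then show "(\<Sum>i\<le>j. of_rat (if j = q then if i = p then 1 else 0 else 0) * x i * x j)
        = (if j = q then \<Sum>i\<le>j. if i = p then x i * x j else 0 else 0)"
      by (cases "j = q") simp_all
  qed
  also have "\<dots> = x p * x q"
    using assms by (simp add: sum.delta[of "{..N}" q])
  finally show ?thesis .
qed

text \<open>Homogenization by \<open>x N\<close> of the affine form
  \<open>x m ^ 2 - x m + x (\<sigma> m)\<close>. Adding monomial tables, instead of splitting cases,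
  also covers \<open>\<sigma> m = m\<close>, where the last two terms cancel.\<close>

definition relabel_coeff :: "nat \<Rightarrow> (nat \<Rightarrow> nat) \<Rightarrow> nat \<Rightarrow> nat \<Rightarrow> nat \<Rightarrow> rat" where
  "relabel_coeff N \<sigma> m i j =
     (if j = m then if i = m then 1 else 0 else 0)
     - (if j = N then if i = m then 1 else 0 else 0)
     + (if j = N then if i = \<sigma> m then 1 else 0 else 0)"

lemma quad_form_relabel_coeff:
  assumes "m \<le> N" "\<sigma> m \<le> N"
  shows "quad_form N (relabel_coeff N \<sigma> m) x = x m * x m - x m * x N + x (\<sigma> m) * x N"
  unfolding relabel_coeff_def[abs_def]
  using assms by (simp add: quad_form_add quad_form_diff quad_form_monomial)

lemma poly_morphism_relabel_coeff:
  assumes "\<And>m. m < N \<Longrightarrow> \<sigma> m < N"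
  shows "poly_morphism N (relabel_coeff N \<sigma>)"
  unfolding poly_morphism_def
proof (intro allI impI, elim conjE)
  fix z :: "nat \<Rightarrow> complex" and i
  assume z: "z N = 0" "\<forall>m<N. quad_form N (relabel_coeff N \<sigma> m) z = 0" and "i \<le> N"
  show "z i = 0"
  proof (cases "i = N")
    case False
    then have "i < N" using \<open>i \<le> N\<close> by simp
    then show ?thesis
      using z assms[of i] by (auto simp: quad_form_relabel_coeff less_imp_le)
  qed (use z in simp)
qed

lemma poly_lift_relabel_coeff:
  fixes x :: "nat \<Rightarrow> 'a::field_char_0"
  assumes "\<And>m. m < N \<Longrightarrow> \<sigma> m < N" "\<And>m. m < N \<Longrightarrow> x m = 0 \<or> x m = 1" "x N = 1"
  shows "poly_lift N (relabel_coeff N \<sigma>) x =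
    (\<lambda>m. if m < N then x (\<sigma> m) else if m = N then 1 else 0)"
proof
  fix m
  show "poly_lift N (relabel_coeff N \<sigma>) x m =
    (if m < N then x (\<sigma> m) else if m = N then 1 else 0)"
    using assms(1,2)[of m] assms(3)
    by (auto simp: poly_lift_def quad_form_relabel_coeff less_imp_le)
qed

lemma primitive_period_ge:
  assumes "is_periodic f P" "\<And>n. has_period f P n \<Longrightarrow> L \<le> n"
  shows "L \<le> primitive_period f P"
  using assms LeastI_ex[of "has_period f P"]
  by (simp add: is_periodic_def primitive_period_def)

text \<open>The last coordinate forces the scaling factor to be 1, so iterates of a class can be
  compared as plain vectors.\<close>

lemma normalized_class_eq_iff:
  assumes "x \<in> hcoords N" "y \<in> hcoords N" "x N = 1" "y N = 1"
  shows "proj_rel N `` {x} = proj_rel N `` {y} \<longleftrightarrow> x = y"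
proof -
  have "x = y" if "(x, y) \<in> proj_rel N"
    using that assms(3,4) by (auto simp: proj_rel_def dest: fun_cong[of _ _ N])
  then show ?thesis
    using eq_equiv_class[OF _ equiv_proj_rel] assms(2) by blast
qed

text \<open>A common divisor \<open>d\<close> divides the difference \<open>(j - i) * M\<close>. It
  is coprime to \<open>M\<close>, since both numbers are 1 modulo \<open>M\<close>, and to
  \<open>j - i\<close>, which divides \<open>fact k\<close> and hence \<open>M\<close>. So
  \<open>d\<close> is a unit.\<close>

lemma coprime_Suc_mult:
  fixes M :: nat
  assumes "fact k dvd M" "i < k" "j < k" "i \<noteq> j"
  shows "coprime (1 + (i + 1) * M) (1 + (j + 1) * M)"
  using assms
proof (induction i j rule: linorder_wlog)
  case (sym a b)
  then show ?case by (simp add: coprime_commute)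
next
  case (le i j)
  show ?case
  proof (rule coprimeI)
    fix d assume d: "d dvd 1 + (i + 1) * M" "d dvd 1 + (j + 1) * M"
    have "1 + (j + 1) * M - (1 + (i + 1) * M) = (j - i) * M"
      using le by (simp add: diff_mult_distrib)
    then have dM: "d dvd (j - i) * M"
      using dvd_diff_nat[OF d(2,1)] by simp
    have cop: "coprime (1 + (i + 1) * M) M"
      by (metis add.commute coprime_1_left coprime_iff_gcd_eq_1 gcd_add_mult mult.commute gcd.commute)
    have "j - i dvd M"
      using le by (intro dvd_trans[OF dvd_fact assms(1)]) auto
    then have "coprime d (j - i)" "coprime d M"
      using cop d(1) by (meson coprime_divisors dvd_refl)+
    then show "is_unit d"
      using dM by (metis coprime_dvd_mult_right_iff coprime_common_divisor dvd_refl)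
  qed
qed

text \<open>The indices are arranged in \<open>k\<close> rows of length \<open>Q\<close>; \<open>\<sigma>\<close> runs cyclically through the first \<open>q i\<close>
  entries of row \<open>i\<close>.\<close>

lemma coprime_cycles_point:
  fixes q :: "nat \<Rightarrow> nat"
  assumes q: "\<And>i. i < k \<Longrightarrow> 0 < q i \<and> q i \<le> Q" and "k * Q \<le> N"
    and cop: "\<And>i j. i < k \<Longrightarrow> j < k \<Longrightarrow> i \<noteq> j \<Longrightarrow> coprime (q i) (q j)"
  shows "\<exists>\<phi>. poly_morphism N \<phi> \<and> (\<exists>P :: (nat \<Rightarrow> rat) set. P \<in> proj_space N \<and>
    is_periodic (proj_map N \<phi>) P \<and> prod q {..<k} \<le> primitive_period (proj_map N \<phi>) P)"
proof -
  \<comment> \<open>Entries of row \<open>i\<close> from position \<open>q i\<close> on lead into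
    the cycle, and indices past the rows are fixed, so \<open>\<sigma>\<close> need not be a
    permutation.\<close>
  define \<sigma> where
    "\<sigma> j = (if j div Q < k then j div Q * Q + (j mod Q + 1) mod q (j div Q) else j)" for j
  \<comment> \<open>Closed form, below \<open>N\<close>, of \<open>v 0\<close> composed with the
    \<open>n\<close>-th iterate of \<open>\<sigma>\<close>; exactly one entry on each cycle is 1.
    Coordinate \<open>N\<close> stays 1.\<close>
  define v :: "nat \<Rightarrow> nat \<Rightarrow> rat" where
    "v n j = (if j = N then 1
      else if j < N \<and> j div Q < k \<and> q (j div Q) dvd j mod Q + n then 1 else 0)" for n j
  define \<phi> where "\<phi> = relabel_coeff N \<sigma>"
  define L where "L = prod q {..<k}"
  have row: "(i * Q + r) div Q = i" "(i * Q + r) mod Q = r" "i * Q + r < N"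
    if "i < k" "r < q i" for i r
  proof -
    have "r < Q" using q[OF that(1)] that(2) by simp
    then show "(i * Q + r) div Q = i" "(i * Q + r) mod Q = r" by simp_all
    have "i * Q + r < (i + 1) * Q" using \<open>r < Q\<close> by simp
    also have "\<dots> \<le> k * Q" using that(1) by (intro mult_le_mono1) simp
    finally show "i * Q + r < N" using \<open>k * Q \<le> N\<close> by simp
  qed
  have \<sigma>_less: "\<sigma> m < N" if "m < N" for m
    using that row(3)[of "m div Q"] q[of "m div Q"] by (simp add: \<sigma>_def)
  have mor: "poly_morphism N \<phi>"
    unfolding \<phi>_def by (rule poly_morphism_relabel_coeff) (rule \<sigma>_less)
  have v_\<sigma>: "v n (\<sigma> m) = v (Suc n) m" if "m < N" for n m
  proof (cases "m div Q < k")
    case True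
    define r where "r = (m mod Q + 1) mod q (m div Q)"
    have r: "r < q (m div Q)" using q[OF True] by (simp add: r_def)
    have "\<sigma> m = m div Q * Q + r" using True by (simp add: \<sigma>_def r_def)
    then have "v n (\<sigma> m) = (if q (m div Q) dvd r + n then 1 else 0)"
      using row[OF True r] True by (simp add: v_def)
    \<comment> \<open>Reducing a position modulo the cycle length does not change divisibility by
      that length, so applying \<open>\<sigma>\<close> once amounts to raising \<open>n\<close> by
      one.\<close>
    moreover have "q (m div Q) dvd r + n \<longleftrightarrow> q (m div Q) dvd m mod Q + Suc n"
      by (simp add: r_def dvd_eq_mod_eq_0 mod_simps)
    ultimately show ?thesis using True that by (simp add: v_def)
  next
    case False
    then show ?thesis using that by (simp add: \<sigma>_def v_def)
  qed
  have v_hcoords: "v n \<in> hcoords N" and v_N: "v n N = 1" for n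
    by (auto simp: hcoords_def v_def)
  have lift_v: "poly_lift N \<phi> (v n) = v (Suc n)" for n
    unfolding \<phi>_def
    by (subst poly_lift_relabel_coeff[OF \<sigma>_less])
       (auto simp: v_\<sigma> fun_eq_iff v_N, auto simp: v_def)
  define P where "P = proj_rel N `` {v 0}"
  have iter: "(proj_map N \<phi> ^^ n) P = proj_rel N `` {v n}" for n
    by (induction n) (simp_all add: P_def proj_map_class[OF mor v_hcoords] lift_v)
  have per: "has_period (proj_map N \<phi>) P n \<longleftrightarrow> n \<ge> 1 \<and> v n = v 0" for n
    using iter[of n] normalized_class_eq_iff[OF v_hcoords v_hcoords v_N v_N]
    by (simp add: has_period_def P_def)
  have "v L = v 0"
  proof
    fix j
    have "q (j div Q) dvd L" if "j div Q < k"
      using that unfolding L_def by (intro dvd_prodI) auto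
    then show "v L j = v 0 j"
      by (auto simp: v_def dvd_add_left_iff)
  qed
  moreover have "L \<ge> 1"
    using q unfolding L_def by (auto intro!: prod_ge_1 simp: Suc_le_eq)
  ultimately have "is_periodic (proj_map N \<phi>) P"
    unfolding is_periodic_def using per by blast
  moreover have "L \<le> n" if "has_period (proj_map N \<phi>) P n" for n
  proof -
    have "q i dvd n" if "i < k" for i
    proof -
      \<comment> \<open>The first entry of row \<open>i\<close> is 1 in \<open>v 0\<close>; it is 1
        in \<open>v n\<close> only if \<open>q i\<close> divides \<open>n\<close>.\<close>
      have "v n (i * Q) = v 0 (i * Q)"
        using \<open>has_period _ P n\<close> per by simp
      then show ?thesis
        using row[of i 0] q[of i] that by (simp add: v_def split: if_splits)
    qed
    then have "L dvd n"
      using coprime_cong_prod_nat[of "{..<k}" q n 0] cop by (simp add: L_def cong_0_iff)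
    then show ?thesis
      using that by (auto simp: has_period_def dest: dvd_imp_le)
  qed
  ultimately have "L \<le> primitive_period (proj_map N \<phi>) P"
    by (intro primitive_period_ge)
  moreover have "P \<in> proj_space N"
    unfolding P_def proj_space_def using v_hcoords by (rule quotientI)
  ultimately show ?thesis
    using mor \<open>is_periodic (proj_map N \<phi>) P\<close> unfolding L_def by blast
qed

theorem theorem3:
  fixes k :: nat
  assumes "k \<ge> 1"
  shows "\<exists>(c::real) > 0. \<exists>N0::nat. \<forall>N\<ge>N0.
           \<exists>\<phi> :: nat \<Rightarrow> nat \<Rightarrow> nat \<Rightarrow> rat. poly_morphism N \<phi> \<and>
             (\<exists>P :: (nat \<Rightarrow> rat) set. P \<in> proj_space N \<and>
                is_periodic (proj_map N \<phi>) P \<and>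
                real (primitive_period (proj_map N \<phi>) P) > c * real N ^ k)"
proof -
  \<comment> \<open>With \<open>M = fact k * t\<close>, the \<open>k\<close> rows of length
    \<open>1 + k * M \<le> 2 * k * M\<close> take up at most \<open>D * t\<close> indices.\<close>
  define D :: nat where "D = 2 * k * k * fact k"
  have "D > 0" using assms by (simp add: D_def)
  show ?thesis
  \<comment> \<open>For \<open>t = N div D\<close>, the bound \<open>N \<ge> D\<close> gives
    \<open>t \<ge> 1\<close> and so \<open>N < D * (t + 1) \<le> 2 * D * t\<close>. Each cycle
    length exceeds \<open>t\<close>, hence their product exceeds
    \<open>(N / (2 * D)) ^ k\<close>.\<close>
  proof (intro exI[of _ "(1 / (2 * real D)) ^ k"] exI[of _ D] conjI allI impI)
    show "(1 / (2 * real D)) ^ k > 0" using \<open>D > 0\<close> by simp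
    fix N assume "N \<ge> D"
    define t where "t = N div D"
    define M where "M = fact k * t"
    define q where "q i = 1 + (i + 1) * M" for i
    have "t \<ge> 1" using \<open>N \<ge> D\<close> \<open>D > 0\<close> by (simp add: t_def div_greater_zero_iff Suc_le_eq)
    then have "t \<le> M" "M \<ge> 1" by (simp_all add: M_def Suc_le_eq)
    have q_bounds: "0 < q i \<and> q i \<le> 1 + k * M" if "i < k" for i
      using mult_le_mono1[of "i + 1" k M] that by (simp add: q_def)
    have "1 \<le> k * M" using assms \<open>M \<ge> 1\<close> by (simp add: Suc_le_eq)
    then have "k * (1 + k * M) \<le> k * (2 * (k * M))" by (intro mult_le_mono2) simp
    also have "\<dots> = D * t" by (simp add: D_def M_def)
    also have "\<dots> \<le> N" by (simp add: t_def)
    finally have "k * (1 + k * M) \<le> N" .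
    moreover have "coprime (q i) (q j)" if "i < k" "j < k" "i \<noteq> j" for i j
      unfolding q_def using that by (intro coprime_Suc_mult[of k]) (simp_all add: M_def)
    ultimately obtain \<phi> and P :: "(nat \<Rightarrow> rat) set"
      where \<phi>: "poly_morphism N \<phi>" "P \<in> proj_space N" "is_periodic (proj_map N \<phi>) P"
        "prod q {..<k} \<le> primitive_period (proj_map N \<phi>) P"
      using coprime_cycles_point[of k q "1 + k * M" N] q_bounds by blast
    have "N < D * t + D"
      using \<open>D > 0\<close> unfolding t_def by (metis mult.commute dividend_less_div_times add.commute)
    also have "\<dots> \<le> 2 * D * t" using \<open>t \<ge> 1\<close> by simp
    finally have "real N \<le> 2 * real D * real t"
      by (metis less_imp_le of_nat_le_iff of_nat_mult of_nat_numeral)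
    then have "1 / (2 * real D) * real N \<le> real t"
      using \<open>D > 0\<close> by (simp add: field_simps)
    then have "(1 / (2 * real D)) ^ k * real N ^ k \<le> real t ^ k"
      unfolding power_mult_distrib[symmetric] by (intro power_mono) simp_all
    also have "t ^ k < prod q {..<k}"
    proof -
      \<comment> \<open>Strictness needs at least one factor, which \<open>k \<ge> 1\<close>
        provides.\<close>
      have "(\<Prod>i<k. t) < prod q {..<k}"
        using assms \<open>t \<ge> 1\<close> \<open>t \<le> M\<close> by (intro prod_mono_strict[of 0]) (auto simp: q_def)
      then show ?thesis by simp
    qed
    then have "real t ^ k < real (prod q {..<k})"
      by (metis of_nat_less_iff of_nat_power)
    also have "\<dots> \<le> real (primitive_period (proj_map N \<phi>) P)"
      using \<phi>(4) by (rule of_nat_mono)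
    finally show "\<exists>\<phi>. poly_morphism N \<phi> \<and> (\<exists>P :: (nat \<Rightarrow> rat) set. P \<in> proj_space N \<and>
        is_periodic (proj_map N \<phi>) P \<and>
        (1 / (2 * real D)) ^ k * real N ^ k < real (primitive_period (proj_map N \<phi>) P))"
      using \<phi>(1-3) by blast
  qed
qed

end
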